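(* Let $t\ge 2$, let $\mathcal{M}=(E_t,\mathcal{T})$ be a simple oriented matroid on the ground set $E_t=\{1,\ldots,t\}$ with set of topes $\mathcal{T}\subseteq\{1,-1\}^t$, and let $\boldsymbol{R}$ be a symmetric cycle in the tope graph of $\mathcal{M}$. For any tope $T$ of $\mathcal{M}$ we have $$\sum_{Q\in\boldsymbol{Q}(T,\boldsymbol{R})}d(T,Q)=\frac12\bigl(|\boldsymbol{Q}(T,\boldsymbol{R})|-1\bigr)t$$ and $$|\boldsymbol{Q}(T,\boldsymbol{R})|=1+\frac2t\sum_{Q\in\boldsymbol{Q}(T,\boldsymbol{R})}d(T,Q).$$
   Context: Topes of an oriented matroid are written as vectors in $\{1,-1\}^t\subset\mathbb{R}^t$ (the signs $+,-$ are replaced by the real numbers $1,-1$). "Simple" means without loops, parallel or antiparallel elements. The tope graph has vertex set $\mathcal{T}$, two topes being adjacent iff they differ in exactly one component; the graph distance $d(T',T'')$ between topes equals the Hamming distance (number of components in which $T'$ and $T''$ differ). A symmetric cycle in the tope graph is a cycle $\boldsymbol{R}=(R^0,R^1,\ldots,R^{2t-1},R^0)$ of length $2t$ (with $2t$ distinct vertices) such that $R^{k+t}=-R^k$ for $0\le k\le t-1$. It is known that for every $T\in\mathcal{T}$ there is a unique inclusion-minimal subset of $\{R^0,\ldots,R^{2t-1}\}$ whose elements sum (in $\mathbb{R}^t$) to $T$; this subset is denoted $\boldsymbol{Q}(T,\boldsymbol{R})$. *)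

theory Defs
  imports "HOL-Analysis.Finite_Cartesian_Product"
begin

text \<open>
  The ground set is the finite index type \<open>'n\<close>, so \<open>t = CARD('n)\<close>. Sign vectors are
  real vectors, with the signs \<open>+\<close>, \<open>-\<close>, \<open>0\<close> written as the numbers \<open>1\<close>, \<open>-1\<close>, \<open>0\<close>.
\<close>

definition sign_vector :: "real ^ 'n \<Rightarrow> bool" where
  "sign_vector X \<longleftrightarrow> (\<forall>e. X $ e \<in> {-1, 0, 1})"

definition sv_comp :: "real ^ 'n \<Rightarrow> real ^ 'n \<Rightarrow> real ^ 'n" where
  "sv_comp X Y = (\<chi> e. if X $ e \<noteq> 0 then X $ e else Y $ e)"

definition sep :: "real ^ 'n \<Rightarrow> real ^ 'n \<Rightarrow> 'n set" where
  "sep X Y = {e. X $ e \<noteq> 0 \<and> X $ e = - (Y $ e)}"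

definition conforms :: "real ^ 'n \<Rightarrow> real ^ 'n \<Rightarrow> bool" where
  "conforms X Y \<longleftrightarrow> (\<forall>e. X $ e \<noteq> 0 \<longrightarrow> X $ e = Y $ e)"

text \<open>An oriented matroid is given by its set of covectors, with the usual covector axioms.\<close>

definition oriented_matroid :: "(real ^ 'n) set \<Rightarrow> bool" where
  "oriented_matroid L \<longleftrightarrow>
     (\<forall>X\<in>L. sign_vector X) \<and>
     0 \<in> L \<and>
     (\<forall>X\<in>L. - X \<in> L) \<and>
     (\<forall>X\<in>L. \<forall>Y\<in>L. sv_comp X Y \<in> L) \<and>
     (\<forall>X\<in>L. \<forall>Y\<in>L. \<forall>e\<in>sep X Y.
        \<exists>Z\<in>L. Z $ e = 0 \<and> (\<forall>f. f \<notin> sep X Y \<longrightarrow> Z $ f = sv_comp X Y $ f))"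

definition loop :: "(real ^ 'n) set \<Rightarrow> 'n \<Rightarrow> bool" where
  "loop L e \<longleftrightarrow> (\<forall>X\<in>L. X $ e = 0)"

definition parallel :: "(real ^ 'n) set \<Rightarrow> 'n \<Rightarrow> 'n \<Rightarrow> bool" where
  "parallel L e f \<longleftrightarrow> (\<forall>X\<in>L. X $ e = X $ f)"

definition antiparallel :: "(real ^ 'n) set \<Rightarrow> 'n \<Rightarrow> 'n \<Rightarrow> bool" where
  "antiparallel L e f \<longleftrightarrow> (\<forall>X\<in>L. X $ e = - (X $ f))"

definition simple_oriented_matroid :: "(real ^ 'n) set \<Rightarrow> bool" where
  "simple_oriented_matroid L \<longleftrightarrow>
     oriented_matroid L \<and> (\<forall>e. \<not> loop L e) \<and>
     (\<forall>e f. e \<noteq> f \<longrightarrow> \<not> parallel L e f \<and> \<not> antiparallel L e f)"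

text \<open>Topes are the maximal covectors; without loops they have all components in \<open>{1, -1}\<close>.\<close>

definition topes :: "(real ^ 'n) set \<Rightarrow> (real ^ 'n) set" where
  "topes L = {T \<in> L. \<forall>X\<in>L. conforms T X \<longrightarrow> X = T}"

definition tope_edges :: "(real ^ 'n) set \<Rightarrow> ((real ^ 'n) \<times> (real ^ 'n)) set" where
  "tope_edges L =
     {(S, T). S \<in> topes L \<and> T \<in> topes L \<and> card {e. S $ e \<noteq> T $ e} = 1}"

text \<open>The \<open>n\<close>-th relational power of the edge relation consists of the end points of walks
  with \<open>n\<close> edges, so this is the graph distance in the tope graph.\<close>

definition tope_dist :: "(real ^ 'n) set \<Rightarrow> real ^ 'n \<Rightarrow> real ^ 'n \<Rightarrow> nat" where
  "tope_dist L S T = (LEAST n. (S, T) \<in> tope_edges L ^^ n)"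

text \<open>Only the values \<open>R 0, \<dots>, R (2 * CARD('n) - 1)\<close> matter.\<close>

definition symmetric_cycle :: "(real ^ 'n) set \<Rightarrow> (nat \<Rightarrow> real ^ 'n) \<Rightarrow> bool" where
  "symmetric_cycle L R \<longleftrightarrow>
     inj_on R {..<2 * CARD('n)} \<and>
     (\<forall>k<2 * CARD('n). (R k, R (Suc k mod (2 * CARD('n)))) \<in> tope_edges L) \<and>
     (\<forall>k<CARD('n). R (k + CARD('n)) = - R k)"

definition minimal_decomposition ::
    "(nat \<Rightarrow> real ^ 'n) \<Rightarrow> real ^ 'n \<Rightarrow> (real ^ 'n) set \<Rightarrow> bool" where
  "minimal_decomposition R T S \<longleftrightarrow>
     S \<subseteq> R ` {..<2 * CARD('n)} \<and> \<Sum>S = T \<and> (\<forall>S'. S' \<subset> S \<longrightarrow> \<Sum>S' \<noteq> T)"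

definition QQ :: "real ^ 'n \<Rightarrow> (nat \<Rightarrow> real ^ 'n) \<Rightarrow> (real ^ 'n) set" where
  "QQ T R = (THE S. minimal_decomposition R T S)"

end

theory Submission
  imports Defs
begin

text \<open>
  Writing topes as \<open>\<plusminus>1\<close> vectors gives \<open>2 d(T, Q) = t - \<langle>T, Q\<rangle>\<close>, so summing over a
  decomposition \<open>T = \<Sum>Q\<close> and using \<open>\<langle>T, T\<rangle> = t\<close> yields both formulas. Two facts are needed.
  First, graph distance is Hamming distance: if no tope lies strictly between \<open>S\<close> and \<open>T\<close>,
  then elimination produces a covector vanishing exactly on their separation set, and
  simplicity forces that set to be a singleton. Second, the least decomposition exists: each
  coordinate flips exactly once along \<open>R 0, \<dots>, R t\<close>, so \<open>R 0, \<dots>, R (t - 1)\<close> is a basis,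
  and the coefficients of a \<open>\<plusminus>1\<close> vector in it are differences of consecutive signs and
  hence lie in \<open>{-1, 0, 1}\<close>.
\<close>

section \<open>Hamming distance and inner products of sign vectors\<close>

definition hamming :: "real ^ 'n \<Rightarrow> real ^ 'n \<Rightarrow> nat" where
  "hamming S T = card {e. S $ e \<noteq> T $ e}"

lemma hamming_eq_0_iff: "hamming S T = 0 \<longleftrightarrow> S = T"
  by (auto simp: hamming_def vec_eq_iff)

lemma hamming_triangle: "hamming S U \<le> hamming S T + hamming T U"
proof -
  have "{e. S $ e \<noteq> U $ e} \<subseteq> {e. S $ e \<noteq> T $ e} \<union> {e. T $ e \<noteq> U $ e}"
    by auto
  then have "hamming S U \<le> card ({e. S $ e \<noteq> T $ e} \<union> {e. T $ e \<noteq> U $ e})"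
    unfolding hamming_def by (intro card_mono) auto
  also have "\<dots> \<le> hamming S T + hamming T U"
    unfolding hamming_def by (rule card_Un_le)
  finally show ?thesis .
qed

text \<open>A product of two signs is 1 where they agree and -1 where they differ, so each
  disagreement lowers the inner product by 2.\<close>

lemma hamming_inner:
  fixes S T :: "real ^ 'n"
  assumes "\<forall>e. S $ e \<in> {-1, 1}" and "\<forall>e. T $ e \<in> {-1, 1}"
  shows "2 * real (hamming S T) = real CARD('n) - (\<Sum>e\<in>UNIV. S $ e * T $ e)"
proof -
  have "S $ e * T $ e = 1 - 2 * of_bool (S $ e \<noteq> T $ e)" for e
    using assms(1)[rule_format, of e] assms(2)[rule_format, of e] by auto
  then have "(\<Sum>e\<in>UNIV. S $ e * T $ e) = (\<Sum>e\<in>UNIV. 1 - 2 * of_bool (S $ e \<noteq> T $ e))"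
    by simp
  also have "\<dots> = real CARD('n) - 2 * real (hamming S T)"
    by (simp add: sum_subtractf hamming_def flip: sum_distrib_left)
  finally show ?thesis by simp
qed


section \<open>Distances in the tope graph\<close>

lemma sv_comp_nth: "sv_comp X Y $ e = (if X $ e \<noteq> 0 then X $ e else Y $ e)"
  by (simp add: sv_comp_def)

text \<open>A zero of a maximal covector at \<open>e\<close> could be filled by composing with a
  covector that is nonzero at \<open>e\<close>, which exists because \<open>e\<close> is not a
  loop.\<close>

lemma tope_iff:
  assumes "simple_oriented_matroid L"
  shows "T \<in> topes L \<longleftrightarrow> T \<in> L \<and> (\<forall>e. T $ e \<in> {-1, 1})"
proof
  assume T: "T \<in> topes L"
  then have TL: "T \<in> L" and max: "\<And>X. X \<in> L \<Longrightarrow> conforms T X \<Longrightarrow> X = T"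
    by (auto simp: topes_def)
  have om: "oriented_matroid L" and nl: "\<And>e. \<not> loop L e"
    using assms by (auto simp: simple_oriented_matroid_def)
  have "T $ e \<noteq> 0" for e
  proof
    assume 0: "T $ e = 0"
    obtain X where X: "X \<in> L" "X $ e \<noteq> 0" using nl[of e] by (auto simp: loop_def)
    have "sv_comp T X \<in> L" using om TL X by (auto simp: oriented_matroid_def)
    moreover have "conforms T (sv_comp T X)" by (auto simp: conforms_def sv_comp_nth)
    ultimately have "sv_comp T X = T" by (rule max)
    then have "sv_comp T X $ e = 0" using 0 by simp
    then show False using 0 X by (simp add: sv_comp_nth)
  qed
  moreover have "T $ e \<in> {-1, 0, 1}" for e
    using om TL by (auto simp: oriented_matroid_def sign_vector_def)
  ultimately show "T \<in> L \<and> (\<forall>e. T $ e \<in> {-1, 1})" using TL by fastforce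
next
  assume T: "T \<in> L \<and> (\<forall>e. T $ e \<in> {-1, 1})"
  then have "T $ e \<noteq> 0" for e by (metis insert_iff neg_equal_zero singletonD zero_neq_one
      zero_neq_neg_one)
  then show "T \<in> topes L"
    using T by (auto simp: topes_def conforms_def vec_eq_iff)
qed

text \<open>Otherwise every tope agreeing with \<open>S\<close> wherever \<open>S\<close> and
  \<open>T\<close> agree is \<open>S\<close> or \<open>T\<close>, so the separated coordinates can
  only change sign together. For two of them this carries over to all covectors and makes them
  parallel or antiparallel.\<close>

lemma tope_strictly_between:
  fixes L :: "(real ^ 'n) set"
  assumes L: "simple_oriented_matroid L"
    and S: "S \<in> topes L" and T: "T \<in> topes L" and D: "hamming S T \<ge> 2"
  shows "\<exists>U\<in>topes L. U \<noteq> S \<and> U \<noteq> T \<and> (\<forall>e. S $ e = T $ e \<longrightarrow> U $ e = S $ e)"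
proof (rule ccontr)
  assume "\<not> ?thesis"
  then have no: "\<And>U. U \<in> topes L \<Longrightarrow> (\<And>e. S $ e = T $ e \<Longrightarrow> U $ e = S $ e) \<Longrightarrow> U = S \<or> U = T"
    by blast
  have comp: "\<And>X Y. X \<in> L \<Longrightarrow> Y \<in> L \<Longrightarrow> sv_comp X Y \<in> L"
    and elim: "\<And>X Y e. X \<in> L \<Longrightarrow> Y \<in> L \<Longrightarrow> e \<in> sep X Y \<Longrightarrow>
      \<exists>Z\<in>L. Z $ e = 0 \<and> (\<forall>f. f \<notin> sep X Y \<longrightarrow> Z $ f = sv_comp X Y $ f)"
    and sgn: "\<And>X e. X \<in> L \<Longrightarrow> X $ e \<in> {-1, 0, 1}"
    using L by (auto simp: simple_oriented_matroid_def oriented_matroid_def sign_vector_def)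
  have SL: "S \<in> L" "\<And>e. S $ e = -1 \<or> S $ e = 1" and TL: "T \<in> L" "\<And>e. T $ e = -1 \<or> T $ e = 1"
    using S T tope_iff[OF L] by auto
  have S0: "S $ e \<noteq> 0" for e
    using SL(2)[of e] by auto
  have opp: "T $ e = - (S $ e)" if "S $ e \<noteq> T $ e" for e
    using SL(2)[of e] TL(2)[of e] that by auto
  have sep: "sep S T = {e. S $ e \<noteq> T $ e}"
    using opp S0 by (fastforce simp: sep_def)
  have full: "sv_comp X Y \<in> topes L" if "X \<in> L" "Y \<in> topes L" for X Y
  proof -
    have "sv_comp X Y $ e \<in> {-1, 1}" for e
      using sgn[OF that(1), of e] that(2) tope_iff[OF L, of Y] by (auto simp: sv_comp_nth)
    then show ?thesis using that comp tope_iff[OF L] by auto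
  qed
  have "\<not> (\<exists>e. {e. S $ e \<noteq> T $ e} \<subseteq> {e})"
  proof
    assume "\<exists>e. {e. S $ e \<noteq> T $ e} \<subseteq> {e}"
    then obtain e where "{e. S $ e \<noteq> T $ e} \<subseteq> {e}" ..
    from card_mono[OF _ this] have "hamming S T \<le> 1" by (simp add: hamming_def)
    then show False using D by simp
  qed
  then obtain e f where ef: "S $ e \<noteq> T $ e" "S $ f \<noteq> T $ f" "e \<noteq> f" by blast
  obtain Z where Z: "Z \<in> L" "Z $ e = 0" "\<And>g. S $ g = T $ g \<Longrightarrow> Z $ g = S $ g"
    using elim[OF SL(1) TL(1), of e] ef(1) S0 unfolding sep by (force simp: sv_comp_nth)
  \<comment> \<open>\<open>Z\<close> vanishes at \<open>e\<close>, so the composite keeps the entry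
    of \<open>S\<close> there; this rules out \<open>T\<close>.\<close>
  have ZS: "sv_comp Z S = S"
  proof -
    have "sv_comp Z S = S \<or> sv_comp Z S = T"
      by (rule no[OF full[OF Z(1) S]]) (use Z(3) in \<open>auto simp: sv_comp_nth\<close>)
    moreover have "sv_comp Z S $ e \<noteq> T $ e" using Z(2) ef(1) by (simp add: sv_comp_nth)
    ultimately show ?thesis by auto
  qed
  have ZT: "sv_comp Z T = T"
  proof -
    have "sv_comp Z T = S \<or> sv_comp Z T = T"
      by (rule no[OF full[OF Z(1) T]]) (use Z(3) in \<open>auto simp: sv_comp_nth\<close>)
    moreover have "sv_comp Z T $ e \<noteq> S $ e" using Z(2) ef(1) by (simp add: sv_comp_nth)
    ultimately show ?thesis by auto
  qed
  \<comment> \<open>A nonzero entry of \<open>Z\<close> at \<open>g\<close> would have to equal both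
    \<open>S $ g\<close> and \<open>T $ g\<close>.\<close>
  have Z0: "Z $ g = 0" if "S $ g \<noteq> T $ g" for g
    using arg_cong[OF ZS, of "\<lambda>v. v $ g"] arg_cong[OF ZT, of "\<lambda>v. v $ g"] that
    by (auto simp: sv_comp_nth split: if_splits)
  \<comment> \<open>Composing with \<open>Z\<close> on the left restores the common entries of
    \<open>S\<close> and \<open>T\<close> and leaves the separated ones, in particular those at
    \<open>e\<close> and \<open>f\<close>, untouched.\<close>
  have key: "sv_comp X V $ e = S $ e \<and> sv_comp X V $ f = S $ f \<or>
      sv_comp X V $ e = - (S $ e) \<and> sv_comp X V $ f = - (S $ f)"
    if X: "X \<in> L" and V: "V \<in> topes L" for X V
  proof -
    have "sv_comp Z (sv_comp X V) = S \<or> sv_comp Z (sv_comp X V) = T"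
      by (rule no[OF full[OF Z(1) full[OF X V]]]) (use Z(3) S0 in \<open>auto simp: sv_comp_nth\<close>)
    moreover have "sv_comp Z (sv_comp X V) $ g = sv_comp X V $ g" if "S $ g \<noteq> T $ g" for g
      using Z0[OF that] by (simp add: sv_comp_nth[of Z])
    ultimately show ?thesis using ef opp by metis
  qed
  \<comment> \<open>Filling the zeros of \<open>X\<close> once by \<open>S\<close> and once by
    \<open>T = - S\<close> (at \<open>e\<close> and \<open>f\<close>) shows that \<open>X\<close>
    cannot vanish at exactly one of \<open>e\<close> and \<open>f\<close>.\<close>
  have proportional: "X $ e * S $ f = X $ f * S $ e" if X: "X \<in> L" for X
    using key[OF X S] key[OF X T] opp[OF ef(1)] opp[OF ef(2)] S0[of e] S0[of f]
    by (auto simp: sv_comp_nth split: if_splits)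
  have "parallel L e f \<or> antiparallel L e f"
    using proportional SL(2)[of e] SL(2)[of f] unfolding parallel_def antiparallel_def by fastforce
  then show False using L ef(3) by (auto simp: simple_oriented_matroid_def)
qed

text \<open>An intermediate tope \<open>U\<close> agrees with \<open>S\<close> or with
  \<open>T\<close> in every coordinate, so Hamming distances add up along \<open>S\<close>,
  \<open>U\<close>, \<open>T\<close> and the two shorter walks can be joined.\<close>

lemma tope_walk_exists:
  fixes L :: "(real ^ 'n) set"
  assumes L: "simple_oriented_matroid L"
  shows "S \<in> topes L \<Longrightarrow> T \<in> topes L \<Longrightarrow> (S, T) \<in> tope_edges L ^^ hamming S T"
proof (induction "hamming S T" arbitrary: S T rule: less_induct)
  case less
  consider "hamming S T = 0" | "hamming S T = 1" | "hamming S T \<ge> 2" by linarith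
  then show ?case
  proof cases
    case 1
    then show ?thesis using hamming_eq_0_iff[of S T] by simp
  next
    case 2
    then show ?thesis using less.prems by (simp add: tope_edges_def hamming_def)
  next
    case 3
    obtain U where U: "U \<in> topes L" "U \<noteq> S" "U \<noteq> T" "\<And>e. S $ e = T $ e \<Longrightarrow> U $ e = S $ e"
      using tope_strictly_between[OF L less.prems 3] by blast
    have pm: "V $ e = -1 \<or> V $ e = 1" if "V \<in> topes L" for V e
      using that tope_iff[OF L] by auto
    have "{e. S $ e \<noteq> T $ e} = {e. S $ e \<noteq> U $ e} \<union> {e. U $ e \<noteq> T $ e}"
      using U(4) by fastforce
    moreover have "{e. S $ e \<noteq> U $ e} \<inter> {e. U $ e \<noteq> T $ e} = {}"
    proof -
      have "S $ e = U $ e \<or> U $ e = T $ e" for e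
        using U(4)[of e] pm[OF less.prems(1), of e] pm[OF less.prems(2), of e] pm[OF U(1), of e]
        by auto
      then show ?thesis by blast
    qed
    ultimately have add: "hamming S T = hamming S U + hamming U T"
      unfolding hamming_def by (simp add: card_Un_disjoint)
    have pos: "hamming S U \<noteq> 0" "hamming U T \<noteq> 0"
      using U(2,3) by (auto simp: hamming_eq_0_iff)
    have "(S, U) \<in> tope_edges L ^^ hamming S U"
      by (rule less.hyps[OF _ less.prems(1) U(1)]) (use add pos in linarith)
    moreover have "(U, T) \<in> tope_edges L ^^ hamming U T"
      by (rule less.hyps[OF _ U(1) less.prems(2)]) (use add pos in linarith)
    ultimately show ?thesis unfolding add relpow_add by blast
  qed
qed

lemma hamming_le_walk_length: "(S, T) \<in> tope_edges L ^^ n \<Longrightarrow> hamming S T \<le> n"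
proof (induction n arbitrary: T)
  case 0
  then show ?case by (simp add: hamming_eq_0_iff)
next
  case (Suc n)
  then obtain U where U: "(S, U) \<in> tope_edges L ^^ n" "(U, T) \<in> tope_edges L" by auto
  then have "hamming U T = 1" by (simp add: tope_edges_def hamming_def)
  then show ?case using Suc.IH[OF U(1)] hamming_triangle[of S T U] by linarith
qed

lemma tope_dist_eq_hamming:
  assumes "simple_oriented_matroid L" and "S \<in> topes L" and "T \<in> topes L"
  shows "tope_dist L S T = hamming S T"
  unfolding tope_dist_def
  by (intro Least_equality tope_walk_exists hamming_le_walk_length assms)


section \<open>Decompositions with respect to a symmetric cycle\<close>

lemma symmetric_cycle_tope:
  fixes R :: "nat \<Rightarrow> real ^ 'n"
  assumes "symmetric_cycle L R" and "k < 2 * CARD('n)"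
  shows "R k \<in> topes L"
proof -
  have "(R k, R (Suc k mod (2 * CARD('n)))) \<in> tope_edges L"
    using assms unfolding symmetric_cycle_def by blast
  then show ?thesis by (simp add: tope_edges_def)
qed

text \<open>\<open>e k\<close> is the coordinate that changes between \<open>R k\<close> and
  \<open>R (Suc k)\<close>. As \<open>R CARD('n) = - R 0\<close>, every coordinate must change
  during the first \<open>CARD('n)\<close> steps; there are as many steps as coordinates, so each
  changes exactly once.\<close>

lemma symmetric_cycle_flips:
  fixes R :: "nat \<Rightarrow> real ^ 'n"
  assumes L: "simple_oriented_matroid L" and R: "symmetric_cycle L R"
  obtains e :: "nat \<Rightarrow> 'n" where "e ` {..<CARD('n)} = UNIV"
    and "\<And>i k. i < CARD('n) \<Longrightarrow> k < CARD('n) \<Longrightarrow>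
           R i $ e k = (if i \<le> k then R 0 $ e k else - (R 0 $ e k))"
proof -
  let ?t = "CARD('n)"
  have t0: "0 < ?t" by simp
  have pm: "R k $ c = -1 \<or> R k $ c = 1" if "k < 2 * ?t" for k c
    using symmetric_cycle_tope[OF R that] tope_iff[OF L] by auto
  have "\<exists>c. {c. R k $ c \<noteq> R (Suc k) $ c} = {c}" if "k < ?t" for k
  proof -
    have "(R k, R (Suc k mod (2 * ?t))) \<in> tope_edges L"
    proof -
      have "k < 2 * ?t" using that by simp
      then show ?thesis using R unfolding symmetric_cycle_def by blast
    qed
    moreover have "Suc k mod (2 * ?t) = Suc k" using that by simp
    ultimately show ?thesis by (simp add: tope_edges_def card_1_singleton_iff)
  qed
  then obtain e where e: "\<And>k. k < ?t \<Longrightarrow> {c. R k $ c \<noteq> R (Suc k) $ c} = {e k}"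
    by metis
  have Rt: "R ?t = - R 0"
  proof -
    have "R (0 + ?t) = - R 0" using R t0 unfolding symmetric_cycle_def by blast
    then show ?thesis by simp
  qed
  have surj: "e ` {..<?t} = UNIV"
  proof (rule ccontr)
    assume "e ` {..<?t} \<noteq> UNIV"
    then obtain c where c: "\<And>k. k < ?t \<Longrightarrow> c \<noteq> e k" by auto
    have "i \<le> ?t \<Longrightarrow> R i $ c = R 0 $ c" for i
    proof (induction i)
      case (Suc i)
      then have "c \<notin> {c. R i $ c \<noteq> R (Suc i) $ c}"
        using e[of i] c[of i] by (simp only: Suc_le_eq singleton_iff) simp
      then show ?case using Suc by simp
    qed simp
    from this[of ?t] have "R 0 $ c = 0" by (simp add: Rt)
    then show False using pm[of 0 c] by simp
  qed
  then have inj: "inj_on e {..<?t}" by (intro eq_card_imp_inj_on) auto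
  have "i < ?t \<Longrightarrow> R i $ e k = (if i \<le> k then R 0 $ e k else - (R 0 $ e k))"
    if k: "k < ?t" for i k
  proof (induction i)
    case (Suc i)
    then have i: "i < ?t" and IH: "R i $ e k = (if i \<le> k then R 0 $ e k else - (R 0 $ e k))"
      by auto
    show ?case
    proof (cases "i = k")
      case True
      then have "R k $ e k \<noteq> R (Suc k) $ e k" using e[OF k] by auto
      then have "R (Suc k) $ e k = - (R k $ e k)"
        using pm[of k "e k"] pm[of "Suc k" "e k"] k by auto
      then show ?thesis using IH True by simp
    next
      case False
      then have "e k \<noteq> e i" using inj i k by (auto dest: inj_onD)
      then have "e k \<notin> {c. R i $ c \<noteq> R (Suc i) $ c}" unfolding e[OF i] by simp
      then have "R (Suc i) $ e k = R i $ e k" by simp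
      then show ?thesis using IH False by simp
    qed
  qed simp
  with surj that show thesis by blast
qed

text \<open>
  In signs relative to \<open>R 0\<close>, coordinate \<open>e k\<close> of \<open>\<Sum>i<t. c i *\<^sub>R R i\<close> is twice the \<open>k\<close>-th partial
  sum of \<open>c\<close> minus the total, so the coefficients of a vector are found by telescoping.
\<close>

lemma symmetric_cycle_coefficients:
  fixes R :: "nat \<Rightarrow> real ^ 'n" and T :: "real ^ 'n"
  assumes L: "simple_oriented_matroid L" and R: "symmetric_cycle L R"
    and T: "\<forall>e. T $ e \<in> {-1, 1}"
  obtains x :: "nat \<Rightarrow> real" where "\<And>k. x k \<in> {-1, 0, 1}"
    and "\<And>c. (\<Sum>i<CARD('n). c i *\<^sub>R R i) = T \<longleftrightarrow> (\<forall>k<CARD('n). c k = x k)"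
proof -
  let ?t = "CARD('n)"
  obtain e :: "nat \<Rightarrow> 'n" where e: "e ` {..<?t} = UNIV"
    and flip: "\<And>i k. i < ?t \<Longrightarrow> k < ?t \<Longrightarrow>
           R i $ e k = (if i \<le> k then R 0 $ e k else - (R 0 $ e k))"
    using symmetric_cycle_flips[OF L R] by blast
  have t0: "0 < ?t" by simp
  have pm: "R 0 $ c = -1 \<or> R 0 $ c = 1" for c
    using symmetric_cycle_tope[OF R, of 0] tope_iff[OF L] by auto
  define s where "s k = T $ e k * R 0 $ e k" for k
  have s: "s k = -1 \<or> s k = 1" for k
    using pm[of "e k"] T[rule_format, of "e k"] by (auto simp: s_def)
  \<comment> \<open>The forced value of the sum of the first \<open>k\<close> coefficients, once the
    total is known to be \<open>s (?t - 1)\<close>.\<close>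
  define p where "p k = (case k of 0 \<Rightarrow> 0 | Suc j \<Rightarrow> (s j + s (?t - 1)) / 2)" for k
  define x where "x k = p (Suc k) - p k" for k
  have coord: "(\<Sum>i<?t. c i *\<^sub>R R i) $ e k = R 0 $ e k * (2 * sum c {..<Suc k} - sum c {..<?t})"
    if k: "k < ?t" for c k
  proof -
    have "(\<Sum>i<?t. c i *\<^sub>R R i) $ e k = (\<Sum>i<?t. c i * R i $ e k)" by simp
    also have "\<dots> = (\<Sum>i<?t. R 0 $ e k * (2 * (if i < Suc k then c i else 0) - c i))"
    proof (rule sum.cong)
      fix i assume "i \<in> {..<?t}"
      then have "R i $ e k = (if i \<le> k then R 0 $ e k else - (R 0 $ e k))"
        using k by (intro flip) auto
      then show "c i * R i $ e k = R 0 $ e k * (2 * (if i < Suc k then c i else 0) - c i)"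
        by (cases "i \<le> k") (simp_all add: less_Suc_eq_le)
    qed simp
    also have "\<dots> = R 0 $ e k * (2 * (\<Sum>i<?t. if i < Suc k then c i else 0) - sum c {..<?t})"
      by (simp add: sum_subtractf flip: sum_distrib_left)
    also have "(\<Sum>i<?t. if i < Suc k then c i else 0) = sum c {..<Suc k}"
      by (rule sum.mono_neutral_cong_right) (use k in auto)
    finally show ?thesis .
  qed
  have iff: "(\<Sum>i<?t. c i *\<^sub>R R i) = T \<longleftrightarrow> (\<forall>k<?t. 2 * sum c {..<Suc k} - sum c {..<?t} = s k)"
    for c
  proof -
    have "(\<Sum>i<?t. c i *\<^sub>R R i) = T \<longleftrightarrow> (\<forall>k<?t. (\<Sum>i<?t. c i *\<^sub>R R i) $ e k = T $ e k)"
    proof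
      assume *: "\<forall>k<?t. (\<Sum>i<?t. c i *\<^sub>R R i) $ e k = T $ e k"
      have "(\<Sum>i<?t. c i *\<^sub>R R i) $ g = T $ g" for g
      proof -
        obtain k where "k < ?t" "g = e k" using e by (metis UNIV_I imageE lessThan_iff)
        with * show ?thesis by blast
      qed
      then show "(\<Sum>i<?t. c i *\<^sub>R R i) = T" unfolding vec_eq_iff by blast
    qed simp
    also have "\<dots> \<longleftrightarrow> (\<forall>k<?t. 2 * sum c {..<Suc k} - sum c {..<?t} = s k)"
    proof (intro all_cong)
      fix k assume "k < ?t"
      show "(\<Sum>i<?t. c i *\<^sub>R R i) $ e k = T $ e k \<longleftrightarrow> 2 * sum c {..<Suc k} - sum c {..<?t} = s k"
        unfolding coord[OF \<open>k < ?t\<close>] s_def using pm[of "e k"] by auto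
    qed
    finally show ?thesis .
  qed
  have last: "Suc (?t - 1) = ?t" using t0 by simp
  have p_Suc: "p (Suc k) = (s k + s (?t - 1)) / 2" for k by (simp add: p_def)
  have iff2: "(\<forall>k<?t. 2 * sum c {..<Suc k} - sum c {..<?t} = s k) \<longleftrightarrow>
      (\<forall>k\<le>?t. sum c {..<k} = p k)" for c
  proof
    assume *: "\<forall>k<?t. 2 * sum c {..<Suc k} - sum c {..<?t} = s k"
    \<comment> \<open>For the last index the partial sum is the total, so the equation determines
      the total itself.\<close>
    from *[rule_format, of "?t - 1"] have tot: "sum c {..<?t} = s (?t - 1)"
      unfolding last by simp
    show "\<forall>k\<le>?t. sum c {..<k} = p k"
    proof (intro allI impI)
      fix k assume "k \<le> ?t"
      then show "sum c {..<k} = p k"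
        using *[rule_format, of "k - 1"] tot by (cases k) (auto simp: p_def)
    qed
  next
    assume *: "\<forall>k\<le>?t. sum c {..<k} = p k"
    have "sum c {..<?t} = p ?t" using * by blast
    also have "\<dots> = s (?t - 1)" using p_Suc[of "?t - 1"] unfolding last by simp
    finally have tot: "sum c {..<?t} = s (?t - 1)" .
    show "\<forall>k<?t. 2 * sum c {..<Suc k} - sum c {..<?t} = s k"
    proof (intro allI impI)
      fix k assume "k < ?t"
      then have "sum c {..<Suc k} = p (Suc k)" using * by (meson Suc_leI)
      then show "2 * sum c {..<Suc k} - sum c {..<?t} = s k"
        unfolding tot by (simp add: p_def)
    qed
  qed
  have iff3: "(\<forall>k\<le>?t. sum c {..<k} = p k) \<longleftrightarrow> (\<forall>k<?t. c k = x k)" for c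
  proof
    assume *: "\<forall>k\<le>?t. sum c {..<k} = p k"
    show "\<forall>k<?t. c k = x k"
    proof (intro allI impI)
      fix k assume "k < ?t"
      then show "c k = x k" using *[rule_format, of k] *[rule_format, of "Suc k"]
        by (simp add: x_def)
    qed
  next
    assume *: "\<forall>k<?t. c k = x k"
    show "\<forall>k\<le>?t. sum c {..<k} = p k"
    proof (intro allI impI)
      fix k assume "k \<le> ?t"
      then show "sum c {..<k} = p k"
        by (induction k) (use * in \<open>auto simp: x_def p_def\<close>)
    qed
  qed
  \<comment> \<open>Here \<open>x 0 = (s 0 + s (?t - 1)) / 2\<close>, and
    \<open>x k = (s k - s (k - 1)) / 2\<close> for positive \<open>k\<close>.\<close>
  have "x k \<in> {-1, 0, 1}" for k
    using s[of k] s[of "k - 1"] s[of "?t - 1"] by (cases k) (auto simp: x_def p_def)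
  then show thesis
    by (rule that) (simp only: iff iff2 iff3)
qed

text \<open>The unique coefficients of \<open>T\<close> in the first half of the cycle dictate the
  members: \<open>R k\<close> for coefficient 1 and its antipode for -1. Any other decomposition can
  only add antipodal pairs.\<close>

lemma least_decomposition:
  fixes R :: "nat \<Rightarrow> real ^ 'n" and T :: "real ^ 'n"
  assumes L: "simple_oriented_matroid L" and R: "symmetric_cycle L R"
    and T: "\<forall>e. T $ e \<in> {-1, 1}"
  obtains S where "S \<subseteq> R ` {..<2 * CARD('n)}" and "\<Sum>S = T"
    and "\<And>S'. S' \<subseteq> R ` {..<2 * CARD('n)} \<Longrightarrow> \<Sum>S' = T \<Longrightarrow> S \<subseteq> S'"
proof -
  let ?t = "CARD('n)"
  obtain x :: "nat \<Rightarrow> real" where x: "\<And>k. x k \<in> {-1, 0, 1}"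
    and x_iff: "\<And>c. (\<Sum>i<?t. c i *\<^sub>R R i) = T \<longleftrightarrow> (\<forall>k<?t. c k = x k)"
    using symmetric_cycle_coefficients[OF L R T] by blast
  have inj: "inj_on R {..<2 * ?t}" and anti: "\<And>k. k < ?t \<Longrightarrow> R (k + ?t) = - R k"
    using R by (auto simp: symmetric_cycle_def)
  \<comment> \<open>Antipodality folds the second half of the cycle onto the first, so the
    coefficient of \<open>R i\<close> is a difference of two indicators.\<close>
  have sum_index: "\<Sum>(R ` A) = (\<Sum>i<?t. (of_bool (i \<in> A) - of_bool (i + ?t \<in> A)) *\<^sub>R R i)"
    if A: "A \<subseteq> {..<2 * ?t}" for A
  proof -
    have "\<Sum>(R ` A) = sum R A"
      using sum.reindex[OF inj_on_subset[OF inj A], of "\<lambda>v. v"] by (simp add: o_def)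
    also have "\<dots> = (\<Sum>i<2 * ?t. of_bool (i \<in> A) *\<^sub>R R i)"
      by (rule sum.mono_neutral_cong_left) (use A in auto)
    also have "\<dots> = (\<Sum>i<?t. of_bool (i \<in> A) *\<^sub>R R i) + (\<Sum>i<?t. of_bool (i + ?t \<in> A) *\<^sub>R R (i + ?t))"
    proof -
      have "(\<Sum>i<?t + ?t. g i) = (\<Sum>i<?t. g i) + (\<Sum>i<?t. g (i + ?t))" for g :: "nat \<Rightarrow> real ^ 'n"
        using sum.atLeastLessThan_concat[of 0 ?t "?t + ?t" g] sum.shift_bounds_nat_ivl[of g 0 ?t ?t]
        by (simp add: lessThan_atLeast0)
      then show ?thesis by (simp only: mult_2)
    qed
    also have "\<dots> = (\<Sum>i<?t. (of_bool (i \<in> A) - of_bool (i + ?t \<in> A)) *\<^sub>R R i)"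
      by (simp add: anti scaleR_diff_left sum_subtractf sum_negf)
    finally show ?thesis .
  qed
  have sum_iff: "\<Sum>(R ` A) = T \<longleftrightarrow> (\<forall>k<?t. of_bool (k \<in> A) - of_bool (k + ?t \<in> A) = x k)"
    if "A \<subseteq> {..<2 * ?t}" for A
    unfolding sum_index[OF that] by (rule x_iff)
  define B where "B = {k. k < ?t \<and> x k = 1} \<union> (\<lambda>k. k + ?t) ` {k. k < ?t \<and> x k = -1}"
  have B: "B \<subseteq> {..<2 * ?t}" by (auto simp: B_def)
  show thesis
  proof
    show "R ` B \<subseteq> R ` {..<2 * ?t}" using B by auto
    have "of_bool (k \<in> B) - of_bool (k + ?t \<in> B) = x k" if "k < ?t" for k
      using x[of k] that by (auto simp: B_def)
    then show "\<Sum>(R ` B) = T" using sum_iff[OF B] by blast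
    fix S' assume "S' \<subseteq> R ` {..<2 * ?t}" and S': "\<Sum>S' = T"
    then obtain A where A: "A \<subseteq> {..<2 * ?t}" "S' = R ` A" by (meson subset_imageE)
    have c: "of_bool (k \<in> A) - of_bool (k + ?t \<in> A) = x k" if "k < ?t" for k
      using sum_iff[OF A(1)] S' A(2) that by blast
    \<comment> \<open>A difference of two indicators is 1 only if the first holds, and -1 only if
      the second does.\<close>
    have "k \<in> A" if "k < ?t" "x k = 1" for k
      using c[OF that(1)] that(2) by (auto simp: of_bool_def split: if_splits)
    moreover have "k + ?t \<in> A" if "k < ?t" "x k = -1" for k
      using c[OF that(1)] that(2) by (auto simp: of_bool_def split: if_splits)
    ultimately have "B \<subseteq> A" by (auto simp: B_def)
    then show "R ` B \<subseteq> S'" using A(2) by auto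
  qed
qed

text \<open>A least decomposition is minimal, and any minimal one contains it and so equals it;
  hence the description in \<open>QQ\<close> denotes it.\<close>

lemma QQ_decomposition:
  fixes R :: "nat \<Rightarrow> real ^ 'n" and T :: "real ^ 'n"
  assumes "simple_oriented_matroid L" and "symmetric_cycle L R"
    and "\<forall>e. T $ e \<in> {-1, 1}"
  shows "QQ T R \<subseteq> R ` {..<2 * CARD('n)}" and "\<Sum>(QQ T R) = T"
proof -
  obtain S where S: "S \<subseteq> R ` {..<2 * CARD('n)}" "\<Sum>S = T"
    and least: "\<And>S'. S' \<subseteq> R ` {..<2 * CARD('n)} \<Longrightarrow> \<Sum>S' = T \<Longrightarrow> S \<subseteq> S'"
    using least_decomposition[OF assms] by blast
  have "QQ T R = S"
    unfolding QQ_def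
  proof (rule the_equality)
    show "minimal_decomposition R T S"
      unfolding minimal_decomposition_def using S least by blast
    show "S' = S" if "minimal_decomposition R T S'" for S'
      using that S least unfolding minimal_decomposition_def by blast
  qed
  then show "QQ T R \<subseteq> R ` {..<2 * CARD('n)}" and "\<Sum>(QQ T R) = T" using S by auto
qed

section \<open>Summing the distances over the decomposition\<close>

theorem mainTheorem3:
  fixes L :: "(real ^ 'n) set"
    and R :: "nat \<Rightarrow> real ^ 'n"
    and T :: "real ^ 'n"
  assumes "CARD('n) \<ge> 2"
    and "simple_oriented_matroid L"
    and "symmetric_cycle L R"
    and "T \<in> topes L"
  shows "(\<Sum>Q\<in>QQ T R. real (tope_dist L T Q)) =
           1 / 2 * (real (card (QQ T R)) - 1) * real CARD('n) \<and>
         real (card (QQ T R)) =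
           1 + 2 / real CARD('n) * (\<Sum>Q\<in>QQ T R. real (tope_dist L T Q))"
proof -
  have T: "\<forall>e. T $ e \<in> {-1, 1}" using assms(4) tope_iff[OF assms(2)] by blast
  note Q = QQ_decomposition[OF assms(2,3) T]
  have "2 * real (tope_dist L T Q) = real CARD('n) - (\<Sum>e\<in>UNIV. T $ e * Q $ e)"
    if "Q \<in> QQ T R" for Q
  proof -
    have "Q \<in> topes L" using that Q(1) symmetric_cycle_tope[OF assms(3)] by auto
    then show ?thesis
      using hamming_inner[OF T] tope_iff[OF assms(2)] tope_dist_eq_hamming[OF assms(2,4)] by auto
  qed
  then have "2 * (\<Sum>Q\<in>QQ T R. real (tope_dist L T Q)) =
      (\<Sum>Q\<in>QQ T R. real CARD('n) - (\<Sum>e\<in>UNIV. T $ e * Q $ e))"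
    by (simp add: sum_distrib_left)
  also have "\<dots> = real (card (QQ T R)) * real CARD('n) - (\<Sum>Q\<in>QQ T R. \<Sum>e\<in>UNIV. T $ e * Q $ e)"
    by (simp add: sum_subtractf)
  \<comment> \<open>By linearity the inner products of \<open>T\<close> with the members add up to
    that of \<open>T\<close> with itself, in which every coordinate contributes 1.\<close>
  also have "(\<Sum>Q\<in>QQ T R. \<Sum>e\<in>UNIV. T $ e * Q $ e) = (\<Sum>e\<in>UNIV. T $ e * (\<Sum>(QQ T R)) $ e)"
    by (subst sum.swap) (simp add: sum_distrib_left)
  also have "\<dots> = (\<Sum>e\<in>(UNIV :: 'n set). 1)"
  proof (rule sum.cong)
    show "T $ e * (\<Sum>(QQ T R)) $ e = 1" for e
      unfolding Q(2) using T[rule_format, of e] by auto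
  qed simp
  finally have key: "2 * (\<Sum>Q\<in>QQ T R. real (tope_dist L T Q)) =
      (real (card (QQ T R)) - 1) * real CARD('n)"
    by (simp add: algebra_simps)
  have solve: "d = 1 / 2 * (q - 1) * t \<and> q = 1 + 2 / t * d"
    if "2 * d = (q - 1) * t" "t \<noteq> 0" for d q t :: real
  proof -
    have "2 / t * d = (2 * d) / t" by simp
    also have "\<dots> = q - 1" using that by simp
    finally show ?thesis using that(1) by simp
  qed
  show ?thesis by (rule solve[OF key]) simp
qed

end
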